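(* Let $n\ge1$ denote a fixed degree and let $r_\omega\in\mathcal{U}_n$ denote the best approximation to $\mathrm{e}^{\mathrm{i} \omega x}$ for $\omega\in(0,(n+1)\pi)$. Let $\mathrm{i} x_1(\omega),\ldots,\mathrm{i} x_{2n+1}(\omega)$ denote the interpolation nodes of $r_\omega$ in ascending order (i.e. $x_1(\omega)<\dots<x_{2n+1}(\omega)$). Then $$x_k(\omega) \to -1 +\frac{k}{n+1},\quad k=1,\ldots,2n+1,\quad \omega\to(n+1)\pi^-.$$ Moreover, let $\eta_1(\omega),\ldots,\eta_{2n+2}(\omega)$ denote the equioscillation points of $r_\omega$ in ascending order. The left-most and right-most of these points are fixed, namely, $\eta_1(\omega)=-1$ and $\eta_{2n+2}(\omega)=1$, and the remaining equioscillation points satisfy $$\eta_{2j}(\omega),\ \eta_{2j+1}(\omega) \to -1+\frac{2j}{n+1}\quad\text{for } j=1,\ldots,n \text{ and } \omega\to(n+1)\pi^-,$$ where $\eta_{2j}(\omega)< x_{2j}(\omega) < \eta_{2j+1}(\omega)$ for $\omega\in(0,(n+1)\pi)$.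
   Context: For a complex polynomial $p$ let $p^\dag(z):=\overline{p}(-z)=\overline{p(-\overline z)}$, where $\overline p$ has complex-conjugated coefficients. Let $\mathcal{U}_n:=\{p^\dag/p : p \text{ a complex polynomial of degree}\le n,\ p\not\equiv 0\}$, with rational functions identified with their irreducible form; then $|r(\mathrm{i}x)|=1$ for $r\in\mathcal{U}_n$, $x\in\mathbb{R}$. For $r\in\mathcal{U}_n$, $\|r-\exp(\omega\cdot)\|:=\max_{x\in[-1,1]}|r(\mathrm{i}x)-\mathrm{e}^{\mathrm{i}\omega x}|$. For $\omega\in(0,(n+1)\pi)$ the best approximation $r_\omega$ is the (existing and unique) element of $\mathcal{U}_n$ with $\|r_\omega-\exp(\omega\cdot)\|=\min_{u\in\mathcal{U}_n}\|u-\exp(\omega\cdot)\|$; this minimum is $<2$. Phase function: if $r\in\mathcal{U}_n$ (in irreducible form) has poles $s_j=\xi_j+\mathrm{i}\mu_j$, $j=1,\dots,m$ (then $\xi_j\neq0$), and $\|r-\exp(\omega\cdot)\|<2$, then there is a unique function of the form $g(x)=\theta+2\sum_{j=1}^m\arctan\big(\frac{x-\mu_j}{\xi_j}\big)$, $\theta\in\mathbb{R}$, with $r(\mathrm{i}x)=\mathrm{e}^{\mathrm{i}g(x)}$ for $x\in\mathbb{R}$ and $\max_{x\in[-1,1]}|g(x)-\omega x|<\pi$. The phase error is $g(x)-\omega x$. For the best approximation with $\omega\in(0,(n+1)\pi)$ there are exactly $2n+2$ points in $[-1,1]$ at which $|g(x)-\omega x|$ attains its maximum over $[-1,1]$, and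 the sign of the phase error alternates between consecutive ones; these are the equioscillation points. The phase error has exactly one zero strictly between each two neighboring equioscillation points and no other zeros in $[-1,1]$; denoting these zeros by $x_1<\dots<x_{2n+1}$, the points $\mathrm{i}x_j$ are the interpolation nodes (where $r_\omega(\mathrm{i}x_j)=\mathrm{e}^{\mathrm{i}\omega x_j}$). *)

theory Defs
  imports
    "HOL-Analysis.Analysis"
    "HOL-Computational_Algebra.Computational_Algebra"
    "HOL-Computational_Algebra.Field_as_Ring"
begin

definition poly_dagger :: "complex poly \<Rightarrow> complex poly" where
  "poly_dagger p = pcompose (map_poly cnj p) [:0, -1:]"

lemma poly_poly_dagger: "poly (poly_dagger p) z = cnj (poly p (- cnj z))"
  by (induction p)
    (simp_all add: poly_dagger_def poly_pcompose map_poly_pCons)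

text \<open>
  Rational functions are elements of the fraction field of the complex polynomials, and
  \<open>quot_of_fract\<close> yields the irreducible form (coprime numerator and monic denominator).
  Values and poles always refer to this irreducible form.
\<close>

definition rat_eval :: "complex poly fract \<Rightarrow> complex \<Rightarrow> complex" where
  "rat_eval r z = poly (fst (quot_of_fract r)) z / poly (snd (quot_of_fract r)) z"

definition rat_poles :: "complex poly fract \<Rightarrow> complex multiset" where
  "rat_poles r = proots (snd (quot_of_fract r))"

definition unitary_rationals :: "nat \<Rightarrow> complex poly fract set" where
  "unitary_rationals n = {Fract (poly_dagger p) p | p. degree p \<le> n \<and> p \<noteq> 0}"

text \<open>
  On \<open>unitary_rationals n\<close> the function below the supremum is continuous, so the supremum is the
  maximum over \<open>[-1,1]\<close>.
\<close>

definition approx_error :: "real \<Rightarrow> complex poly fract \<Rightarrow> real" where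
  "approx_error \<omega> r =
     (SUP x\<in>{-1..1::real}. norm (rat_eval r (\<i> * of_real x) - exp (\<i> * of_real (\<omega> * x))))"

definition is_best_approximation :: "nat \<Rightarrow> real \<Rightarrow> complex poly fract \<Rightarrow> bool" where
  "is_best_approximation n \<omega> r \<longleftrightarrow>
     r \<in> unitary_rationals n \<and>
     (\<forall>u\<in>unitary_rationals n. approx_error \<omega> r \<le> approx_error \<omega> u)"

text \<open>
  The sum runs over the poles with multiplicity. For \<open>g\<close> of the given form the last condition is
  the same as the maximum over \<open>[-1,1]\<close> being less than \<open>pi\<close>.
\<close>

definition is_phase_function :: "real \<Rightarrow> complex poly fract \<Rightarrow> (real \<Rightarrow> real) \<Rightarrow> bool" where
  "is_phase_function \<omega> r g \<longleftrightarrow>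
     (\<exists>\<theta>::real. \<forall>x. g x = \<theta> + 2 * (\<Sum>s\<in>#rat_poles r. arctan ((x - Im s) / Re s))) \<and>
     (\<forall>x. rat_eval r (\<i> * of_real x) = exp (\<i> * of_real (g x))) \<and>
     (\<forall>x\<in>{-1..1}. \<bar>g x - \<omega> * x\<bar> < pi)"

definition phase_error :: "real \<Rightarrow> (real \<Rightarrow> real) \<Rightarrow> real \<Rightarrow> real" where
  "phase_error \<omega> g x = g x - \<omega> * x"

text \<open>
  The points of maximal absolute phase error. Alternation of the sign is not part of the
  definition: it is a property of the best approximation.
\<close>

definition equioscillation_points :: "real \<Rightarrow> (real \<Rightarrow> real) \<Rightarrow> real set" where
  "equioscillation_points \<omega> g =
     {x \<in> {-1..1}. \<forall>y\<in>{-1..1}. \<bar>phase_error \<omega> g y\<bar> \<le> \<bar>phase_error \<omega> g x\<bar>}"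

text \<open>The interpolation nodes are the points \<open>\<i> * of_real x\<close> for \<open>x\<close> in the following set.\<close>

definition node_positions :: "real \<Rightarrow> (real \<Rightarrow> real) \<Rightarrow> real set" where
  "node_positions \<omega> g = {x \<in> {-1..1}. phase_error \<omega> g x = 0}"

definition ascending_enumeration :: "nat \<Rightarrow> real set \<Rightarrow> (nat \<Rightarrow> real) \<Rightarrow> bool" where
  "ascending_enumeration N A a \<longleftrightarrow> strict_mono_on {1..N} a \<and> a ` {1..N} = A"

end

theory Submission
  imports Defs
begin

text \<open>
  The phase error is $e(t) = g(t) - \omega t$, where $g$ is a constant plus twice a sum of at most
  $n$ functions $\arctan((t-\mu)/\xi)$. Two elementary observations about such functions carry the
  proof.

  \<^emph>\<open>Counting critical points.\<close> After clearing denominators, $e'(t) = 0$ is a polynomial equation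
  of degree at most $2n$. By Rolle's theorem the $2n+1$ zeros of $e$ force a critical point in each
  of the $2n$ gaps between them, so there are no others. An extremum of $|e|$ on $[-1,1]$
  is a critical point or an end point, and there are $2n+2$ of them, so the equioscillation points
  are exactly $-1$, the $2n$ critical points and $1$. They separate the nodes, and $e$ has opposite
  signs at neighbouring ones, since equal values would give one critical point too many
  (lemma \<open>nodes_separate_extrema\<close>).

  \<^emph>\<open>Bounding the growth of $g$.\<close> Each arctangent increases by at most $\pi$, so $g$ increases by at
  most $2\pi n$. With $M = e(-1)$ the alternation gives $e(1) = -M$, hence
  $2\omega - 2M = g(1) - g(-1) \le 2\pi n$ and $M \ge \omega - n\pi$, which tends to $\pi$. On each of
  the $n$ intervals on which $e$ rises from $-M$ to $M$ the function $g$ rises by at least $2M$; if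
  only $n-1$ of the arctangents were increasing, this would give $2nM \le 2\pi(n-1)$, impossible for
  $\omega$ near $(n+1)\pi$. So $g$ is increasing there, $e$ can fall with slope at most $\omega$, and
  each of the $n+1$ intervals on which $e$ falls from $M$ through its node to $-M$ has length at
  least $2c$ with $c = (\omega - n\pi)/\omega$. As $c$ tends to $1/(n+1)$, these intervals fill all of
  $[-1,1]$ in the limit, the rising intervals shrink to points, and every node and equioscillation
  point is squeezed to its limit (lemma \<open>equioscillation_gap_bounds\<close>).
\<close>

section \<open>The number of poles\<close>

text \<open>
  Passing to the irreducible form only cancels common factors: the reduced denominator divides $p$,
  being coprime to the reduced numerator.
\<close>

lemma degree_snd_quot_of_fract_Fract_le:
  fixes p q :: "complex poly"
  assumes "p \<noteq> 0"
  shows "degree (snd (quot_of_fract (Fract q p))) \<le> degree p"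
proof -
  let ?a = "fst (quot_of_fract (Fract q p))" and ?b = "snd (quot_of_fract (Fract q p))"
  have nz: "?b \<noteq> 0"
    by simp
  have "Fract ?a ?b = Fract q p"
    by (rule Fract_quot_of_fract)
  then have "?a * p = q * ?b"
    using eq_fract(1)[OF nz assms] by blast
  then have "?b dvd ?a * p"
    by simp
  moreover have "coprime ?b ?a"
    using coprime_quot_of_fract coprime_commute by blast
  ultimately have "?b dvd p"
    by (simp add: coprime_dvd_mult_right_iff)
  then show ?thesis
    using assms by (rule dvd_imp_degree_le)
qed

lemma size_rat_poles_le:
  assumes "r \<in> unitary_rationals n"
  shows "size (rat_poles r) \<le> n"
proof -
  obtain p where p: "degree p \<le> n" "p \<noteq> 0" "r = Fract (poly_dagger p) p"
    using assms by (auto simp: unitary_rationals_def)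
  have "size (rat_poles r) = degree (snd (quot_of_fract r))"
    unfolding rat_poles_def by (rule size_proots_complex)
  also have "\<dots> \<le> degree p"
    using p degree_snd_quot_of_fract_Fract_le by simp
  finally show ?thesis using p by simp
qed

section \<open>Critical points of a sum of arctangents\<close>

text \<open>
  The case $\xi = 0$ is covered by the convention $u/0 = 0$, which makes the function and its
  derivative vanish.
\<close>

lemma arctan_quotient_has_real_derivative:
  fixes \<mu> \<xi> x :: real
  shows "((\<lambda>x. arctan ((x - \<mu>) / \<xi>)) has_real_derivative \<xi> / (\<xi>\<^sup>2 + (x - \<mu>)\<^sup>2)) (at x)"
proof (cases "\<xi> = 0")
  case True
  then show ?thesis by simp
next
  case False
  have "\<xi>\<^sup>2 + (x - \<mu>)\<^sup>2 > 0"
    using False by (simp add: add_pos_nonneg)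
  then have "inverse (1 + ((x - \<mu>) / \<xi>)\<^sup>2) * (1 / \<xi>) = \<xi> / (\<xi>\<^sup>2 + (x - \<mu>)\<^sup>2)"
    using False by (simp add: divide_simps power2_eq_square)
  moreover have "((\<lambda>x. arctan ((x - \<mu>) / \<xi>)) has_real_derivative
      inverse (1 + ((x - \<mu>) / \<xi>)\<^sup>2) * (1 / \<xi>)) (at x)"
    by (rule derivative_eq_intros refl False | simp)+
  ultimately show ?thesis by simp
qed

lemma sum_arctan_has_real_derivative:
  "((\<lambda>x. \<Sum>s\<in>#P. arctan ((x - Im s) / Re s)) has_real_derivative
      (\<Sum>s\<in>#P. Re s / ((Re s)\<^sup>2 + (x - Im s)\<^sup>2))) (at x)"
  by (induction P) (auto intro!: DERIV_add arctan_quotient_has_real_derivative)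

text \<open>
  Each summand has a denominator of degree $2$ without real zeros, so a common denominator has
  degree at most twice the number of summands. A summand with $\operatorname{Re} s = 0$ vanishes and
  must not contribute a factor, since its denominator has a real zero.
\<close>

lemma sum_arctan_derivative_rational:
  "\<exists>A B :: real poly. degree A \<le> 2 * size P \<and> degree B \<le> 2 * size P \<and> (\<forall>x. poly B x \<noteq> 0) \<and>
     (\<forall>x. (\<Sum>s\<in>#P. Re s / ((Re s)\<^sup>2 + (x - Im s)\<^sup>2)) = poly A x / poly B x)"
proof (induction P)
  case empty
  show ?case by (rule exI[of _ 0], rule exI[of _ 1]) simp
next
  case (add s P)
  then obtain A B where AB: "degree A \<le> 2 * size P" "degree B \<le> 2 * size P"
    "\<And>x. poly B x \<noteq> 0"
    "\<And>x. (\<Sum>s\<in>#P. Re s / ((Re s)\<^sup>2 + (x - Im s)\<^sup>2)) = poly A x / poly B x"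
    by blast
  show ?case
  proof (cases "Re s = 0")
    case True
    then show ?thesis
      using AB by (intro exI[of _ A] exI[of _ B]) auto
  next
    case False
    define q where "q = [:(Re s)\<^sup>2 + (Im s)\<^sup>2, - 2 * Im s, 1:]"
    have q: "poly q x = (Re s)\<^sup>2 + (x - Im s)\<^sup>2" for x
      by (simp add: q_def power2_eq_square algebra_simps)
    have q_nz: "poly q x \<noteq> 0" for x
      using False by (simp add: q sum_power2_eq_zero_iff)
    have dq: "degree q = 2" by (simp add: q_def)
    have "degree (A * q + smult (Re s) B) \<le> 2 * size (add_mset s P)"
      using AB degree_mult_le[of A q] degree_smult_le[of "Re s" B] dq
      by (intro degree_add_le) auto
    moreover have "degree (B * q) \<le> 2 * size (add_mset s P)"
      using AB degree_mult_le[of B q] dq by simp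
    moreover have "(\<Sum>s\<in>#add_mset s P. Re s / ((Re s)\<^sup>2 + (x - Im s)\<^sup>2))
        = poly (A * q + smult (Re s) B) x / poly (B * q) x" for x
    proof -
      have "(\<Sum>s\<in>#add_mset s P. Re s / ((Re s)\<^sup>2 + (x - Im s)\<^sup>2))
          = Re s / poly q x + poly A x / poly B x"
        by (simp add: AB(4) q)
      also have "\<dots> = poly (A * q + smult (Re s) B) x / poly (B * q) x"
        using AB(3)[of x] q_nz[of x] by (simp add: add_frac_eq ac_simps)
      finally show ?thesis .
    qed
    ultimately show ?thesis
      using AB(3) q_nz by (intro exI[of _ "A * q + smult (Re s) B"] exI[of _ "B * q"]) auto
  qed
qed

text \<open>
  The first alternative is the degenerate one in which the numerator polynomial vanishes
  identically, so that a phase error with this derivative is constant.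
\<close>

lemma card_critical_points_sum_arctan_le:
  fixes \<omega> :: real and P :: "complex multiset"
  defines "C \<equiv> {x. 2 * (\<Sum>s\<in>#P. Re s / ((Re s)\<^sup>2 + (x - Im s)\<^sup>2)) - \<omega> = 0}"
  shows "C = UNIV \<or> finite C \<and> card C \<le> 2 * size P"
proof -
  obtain A B where AB: "degree A \<le> 2 * size P" "degree B \<le> 2 * size P"
    "\<And>x. poly B x \<noteq> 0"
    "\<And>x. (\<Sum>s\<in>#P. Re s / ((Re s)\<^sup>2 + (x - Im s)\<^sup>2)) = poly A x / poly B x"
    using sum_arctan_derivative_rational[of P] by blast
  define Q where "Q = smult 2 A - smult \<omega> B"
  have "degree Q \<le> 2 * size P"
    unfolding Q_def using AB(1,2) degree_smult_le[of 2 A] degree_smult_le[of \<omega> B]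
    by (intro degree_diff_le) auto
  moreover have "C = {x. poly Q x = 0}"
    unfolding C_def Q_def using AB(3) by (auto simp: AB(4) field_simps)
  ultimately show ?thesis
    using card_poly_roots_bound[of Q] poly_roots_finite[of Q] by (cases "Q = 0") auto
qed

section \<open>Interlacing of nodes and equioscillation points\<close>

text \<open>
  The $k$-th value of an ascending enumeration of $A$ is determined by having exactly $k$ elements
  of $A$ at or below it.
\<close>

lemma ascending_enumeration_unique:
  assumes "ascending_enumeration N A a" "ascending_enumeration N A b" "k \<in> {1..N}"
  shows "a k = b k"
proof -
  have count: "card {y \<in> A. y \<le> c k} = k" if "ascending_enumeration N A c" for c
  proof -
    have mono: "strict_mono_on {1..N} c" and img: "c ` {1..N} = A"
      using that by (auto simp: ascending_enumeration_def)
    have "{y \<in> A. y \<le> c k} = c ` {1..k}"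
      using assms(3) strict_mono_on_less_eq[OF mono] by (auto simp flip: img)
    moreover have "inj_on c {1..k}"
      using assms(3) by (intro inj_on_subset[OF strict_mono_on_imp_inj_on[OF mono]]) auto
    ultimately show ?thesis by (simp add: card_image)
  qed
  have fin: "finite A" and mem: "a k \<in> A" "b k \<in> A"
    using assms by (auto simp: ascending_enumeration_def)
  have less: "card {y \<in> A. y \<le> u} < card {y \<in> A. y \<le> v}" if "u < v" "v \<in> A" for u v
    using that fin by (intro psubset_card_mono) (auto, force)
  show ?thesis
    using less[OF _ mem(1), of "b k"] less[OF _ mem(2), of "a k"]
      count[OF assms(1)] count[OF assms(2)] by (cases "a k" "b k" rule: linorder_cases) auto
qed


text \<open>
  The numbers of zeros and of extrema are the largest that $2n$ critical points permit, so every
  estimate in the count is an equality: the end points and all critical points are extrema, with one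
  zero between neighbours. Rolle's theorem applied between neighbouring extrema then yields the
  alternation, as there is no critical point strictly between them.
\<close>

lemma nodes_separate_extrema:
  fixes e e' :: "real \<Rightarrow> real"
  assumes deriv: "\<And>t. (e has_real_derivative e' t) (at t)"
    and crit: "{t. e' t = 0} = UNIV \<or> finite {t. e' t = 0} \<and> card {t. e' t = 0} \<le> 2 * n"
    and nodes: "ascending_enumeration (2 * n + 1) {t \<in> {-1..1}. e t = 0} x"
    and extrema: "ascending_enumeration (2 * n + 2)
                    {t \<in> {-1..1}. \<forall>y\<in>{-1..1}. \<bar>e y\<bar> \<le> \<bar>e t\<bar>} \<eta>"
  shows "\<eta> 1 = -1" and "\<eta> (2 * n + 2) = 1"
    and "\<And>j. j \<in> {1..2 * n + 1} \<Longrightarrow> \<eta> j < x j \<and> x j < \<eta> (Suc j) \<and> e (\<eta> (Suc j)) = - e (\<eta> j)"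
proof -
  define C where "C = {t. e' t = 0}"
  define Z where "Z = {t \<in> {-1..1}. e t = 0}"
  define E where "E = {t \<in> {-1..1}. \<forall>y\<in>{-1..1}. \<bar>e y\<bar> \<le> \<bar>e t\<bar>}"
  have x_mono: "strict_mono_on {1..2 * n + 1} x" and x_img: "x ` {1..2 * n + 1} = Z"
    using nodes by (auto simp: ascending_enumeration_def Z_def)
  have \<eta>_mono: "strict_mono_on {1..2 * n + 2} \<eta>" and \<eta>_img: "\<eta> ` {1..2 * n + 2} = E"
    using extrema by (auto simp: ascending_enumeration_def E_def)
  have card_E: "card E = 2 * n + 2"
    using card_image[OF strict_mono_on_imp_inj_on[OF \<eta>_mono]] \<eta>_img by simp
  have fin_E: "finite E" using \<eta>_img by auto
  have x_Z: "x j \<in> {-1..1}" "e (x j) = 0" if "j \<in> {1..2 * n + 1}" for j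
    using that x_img by (auto simp: Z_def)
  have x_less: "x i < x j" if "i \<in> {1..2 * n + 1}" "j \<in> {1..2 * n + 1}" "i < j" for i j
    using that x_mono by (auto simp: strict_mono_on_def)
  have Z_proper: "Z \<noteq> {-1..1}"
  proof
    assume "Z = {-1..1}"
    moreover have "finite Z" using x_img by auto
    ultimately show False using infinite_Icc[of "-1::real" 1] by simp
  qed
  have E_nz: "e t \<noteq> 0" if "t \<in> E" for t
  proof
    assume "e t = 0"
    then have "Z = {-1..1}" using that by (auto simp: E_def Z_def)
    then show False using Z_proper by simp
  qed
  have "C \<noteq> UNIV"
  proof
    assume "C = UNIV"
    then have "e' t = 0" for t by (auto simp: C_def)
    then have "(e has_real_derivative 0) (at t)" for t
      using deriv[of t] by simp
    then have "e t = e (x 1)" for t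
      using DERIV_isconst_all by blast
    then have "Z = {-1..1}" using x_Z[of 1] by (auto simp: Z_def)
    then show False using Z_proper by simp
  qed
  then have fin_C: "finite C" and card_C: "card C \<le> 2 * n"
    using crit by (auto simp: C_def)
  have rolle: "\<exists>t. a < t \<and> t < b \<and> t \<in> C" if "a < b" "e a = e b" for a b
  proof -
    have "\<exists>t>a. t < b \<and> e b - e a = (b - a) * e' t"
      using that(1) deriv by (intro MVT2) auto
    then show ?thesis using that by (auto simp: C_def)
  qed
  have "\<forall>j\<in>{1..2 * n}. \<exists>t. x j < t \<and> t < x (Suc j) \<and> t \<in> C"
    by (intro ballI rolle) (auto simp: x_Z intro: x_less)
  then obtain c where c: "\<And>j. j \<in> {1..2 * n} \<Longrightarrow> x j < c j \<and> c j < x (Suc j) \<and> c j \<in> C"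
    by metis
  have "E \<subseteq> insert (-1) (insert 1 C)"
  proof
    fix t assume t: "t \<in> E"
    have "e' t = 0" if "t \<noteq> -1" "t \<noteq> 1"
    proof -
      define d where "d = min (t + 1) (1 - t)"
      have d: "d > 0" using that t by (auto simp: d_def E_def)
      have bound: "\<bar>e y\<bar> \<le> \<bar>e t\<bar>" if "\<bar>t - y\<bar> < d" for y
        using that t by (auto simp: E_def d_def abs_less_iff min_def split: if_splits)
      show "e' t = 0"
      proof (cases "e t > 0")
        case True
        show ?thesis
          by (rule DERIV_local_max[OF deriv d]) (use bound True in force)
      next
        case False
        show ?thesis
          by (rule DERIV_local_min[OF deriv d]) (use bound False in force)
      qed
    qed
    then show "t \<in> insert (-1) (insert 1 C)" by (auto simp: C_def)
  qed
  moreover have "card (insert (-1) (insert 1 C)) \<le> card E"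
    using card_C fin_C card_E by (simp add: card_insert_if)
  ultimately have E_eq: "E = insert (-1) (insert 1 C)"
    using fin_C by (intro card_seteq) auto
  \<comment> \<open>By definition \<open>d\<close> interlaces with the nodes; uniqueness of the ascending enumeration then
    identifies it with \<open>\<eta>\<close>.\<close>
  define d where "d j = (if j = 1 then -1 else if j = 2 * n + 2 then 1 else c (j - 1))" for j
  have dx: "d j < x j \<and> x j < d (Suc j)" if j: "j \<in> {1..2 * n + 1}" for j
  proof
    have "x 1 \<noteq> -1" using E_eq E_nz x_Z(2)[of 1] by force
    then have "-1 < x 1" using x_Z(1)[of 1] by simp
    then show "d j < x j"
      using j c[of "j - 1"] by (cases "j = 1") (auto simp: d_def Suc_le_eq)
    have "x (2 * n + 1) \<noteq> 1" using E_eq E_nz x_Z(2)[of "2 * n + 1"] by force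
    then have "x (2 * n + 1) < 1" using x_Z(1)[of "2 * n + 1"] by simp
    then show "x j < d (Suc j)"
      using j c[of j] by (cases "j = 2 * n + 1") (auto simp: d_def)
  qed
  have d_mono: "strict_mono_on {1..2 * n + 2} d"
  proof (rule strict_mono_onI)
    fix i j assume ij: "i \<in> {1..2 * n + 2}" "j \<in> {1..2 * n + 2}" "i < j"
    have j': "j - 1 \<in> {1..2 * n + 1}" "Suc (j - 1) = j" using ij by auto
    have "d i < x i" using ij dx[of i] by simp
    also have "x i \<le> x (j - 1)"
    proof (cases "i = j - 1")
      case False
      then have "i < j - 1" using ij by auto
      then show ?thesis using ij j' x_less[of i "j - 1"] by auto
    qed simp
    also have "\<dots> < d j" using dx[OF j'(1)] j'(2) by simp
    finally show "d i < d j" .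
  qed
  have "d ` {1..2 * n + 2} = E"
  proof (rule card_subset_eq[OF fin_E])
    have "c (j - 1) \<in> C" if "j \<in> {1..2 * n + 2}" "j \<noteq> 1" "j \<noteq> 2 * n + 2" for j
    proof -
      have "j - 1 \<in> {1..2 * n}" using that by auto
      then show ?thesis using c by blast
    qed
    then show "d ` {1..2 * n + 2} \<subseteq> E"
      unfolding d_def E_eq by auto
    show "card (d ` {1..2 * n + 2}) = card E"
      using card_image[OF strict_mono_on_imp_inj_on[OF d_mono]] card_E by simp
  qed
  then have \<eta>_d: "\<eta> j = d j" if "j \<in> {1..2 * n + 2}" for j
    using ascending_enumeration_unique[of "2 * n + 2" E \<eta> d j] \<eta>_mono \<eta>_img d_mono that
    by (simp add: ascending_enumeration_def)
  show "\<eta> 1 = -1" "\<eta> (2 * n + 2) = 1"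
    by (simp_all add: \<eta>_d) (simp_all add: d_def)
  show "\<eta> j < x j \<and> x j < \<eta> (Suc j) \<and> e (\<eta> (Suc j)) = - e (\<eta> j)"
    if j: "j \<in> {1..2 * n + 1}" for j
  proof -
    have order: "\<eta> j < x j" "x j < \<eta> (Suc j)"
      using dx[OF j] j by (simp_all add: \<eta>_d)
    have "e (\<eta> (Suc j)) \<noteq> e (\<eta> j)"
    proof
      assume "e (\<eta> (Suc j)) = e (\<eta> j)"
      then obtain t where t: "\<eta> j < t" "t < \<eta> (Suc j)" "t \<in> C"
        using rolle[of "\<eta> j" "\<eta> (Suc j)"] order by auto
      then have "t \<in> \<eta> ` {1..2 * n + 2}" using E_eq \<eta>_img by simp
      then obtain i where i: "i \<in> {1..2 * n + 2}" "t = \<eta> i" by blast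
      have "j < i" "i < Suc j"
        using t i j strict_mono_on_less[OF \<eta>_mono, of j i]
          strict_mono_on_less[OF \<eta>_mono, of i "Suc j"] by auto
      then show False by simp
    qed
    moreover have "\<eta> j \<in> E" "\<eta> (Suc j) \<in> E"
      using j \<eta>_img by auto
    then have "\<bar>e (\<eta> (Suc j))\<bar> = \<bar>e (\<eta> j)\<bar>"
      by (auto simp: E_def intro: antisym)
    ultimately show ?thesis using order by (auto simp: abs_eq_iff)
  qed
qed

section \<open>Lengths of the intervals between equioscillation points\<close>

lemma mono_sum_arctan:
  assumes "\<And>s. s \<in># P \<Longrightarrow> Re s \<ge> 0"
  shows "mono (\<lambda>x. \<Sum>s\<in>#P. arctan ((x - Im s) / Re s))"
  using assms by (intro monoI sum_mset_mono) (auto intro!: arctan_monotone' divide_right_mono)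

lemma sum_arctan_diff_le:
  "(\<Sum>s\<in>#P. arctan ((b - Im s) / Re s)) - (\<Sum>s\<in>#P. arctan ((a - Im s) / Re s)) \<le> real (size P) * pi"
proof (induction P)
  case (add s P)
  have "arctan ((b - Im s) / Re s) - arctan ((a - Im s) / Re s) \<le> pi"
    using arctan_bounded[of "(b - Im s) / Re s"] arctan_bounded[of "(a - Im s) / Re s"] by linarith
  then show ?case using add by (simp add: algebra_simps)
qed simp

text \<open>
  The points $\eta_{2i+1}$, $x_{2i+1}$, $\eta_{2i+2}$ are consecutive with distance at least $c$,
  because $e$ falls by at least $\omega c$ between them with slope at least $-\omega$. There are
  $n+1$ such triples, and adding the distances from the left end or from the right end
  of $[-1,1]$ gives the two bounds. The lower bound on $\omega$ is what forces all arctangents to be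
  increasing.
\<close>

lemma equioscillation_gap_bounds:
  fixes n :: nat and \<omega> \<theta> :: real and P :: "complex multiset"
  defines "g \<equiv> \<lambda>t. \<theta> + 2 * (\<Sum>s\<in>#P. arctan ((t - Im s) / Re s))"
  defines "e \<equiv> \<lambda>t. g t - \<omega> * t"
  defines "c \<equiv> (\<omega> - real n * pi) / \<omega>"
  assumes "n \<ge> 1" and size: "size P \<le> n" and \<omega>: "real n * (\<omega> - real n * pi) > (real n - 1) * pi"
    and ends: "\<eta> 1 = -1" "\<eta> (2 * n + 2) = 1"
    and zeros: "\<And>j. j \<in> {1..2 * n + 1} \<Longrightarrow> e (x j) = 0"
    and alternate: "\<And>j. j \<in> {1..2 * n + 1} \<Longrightarrow>
          \<eta> j < x j \<and> x j < \<eta> (Suc j) \<and> e (\<eta> (Suc j)) = - e (\<eta> j)"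
  shows "k \<in> {1..2 * n + 1} \<Longrightarrow> -1 + real k * c \<le> x k \<and> x k \<le> 1 - (real (2 * n + 2) - real k) * c"
    and "j \<in> {1..n} \<Longrightarrow> -1 + real (2 * j) * c \<le> \<eta> (2 * j) \<and> \<eta> (2 * j) \<le> \<eta> (2 * j + 1) \<and>
           \<eta> (2 * j + 1) \<le> 1 - (real (2 * n + 2) - real (2 * j)) * c"
proof -
  define M where "M = e (-1)"
  have \<eta>_less: "\<eta> j < \<eta> (Suc j)" if "j \<in> {1..2 * n + 1}" for j
    using alternate[OF that] by linarith
  have e_odd: "e (\<eta> (2 * i + 1)) = M" if "i \<le> n" for i
    using that
  proof (induction i)
    case (Suc i)
    then show ?case
      using alternate[of "2 * i + 1"] alternate[of "2 * i + 2"] by simp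
  qed (simp add: ends M_def flip: One_nat_def)
  have e_even: "e (\<eta> (2 * i + 2)) = - M" if "i \<le> n" for i
    using alternate[of "2 * i + 1"] e_odd[OF that] that by simp
  have "(real n - 1) * pi \<ge> 0" using \<open>n \<ge> 1\<close> by simp
  then have "real n * (\<omega> - real n * pi) > 0" using \<omega> by linarith
  then have \<omega>_gt: "\<omega> - real n * pi > 0" by (simp add: zero_less_mult_iff)
  then have \<omega>_pos: "\<omega> > 0"
    by (smt (verit) mult_nonneg_nonneg of_nat_0_le_iff pi_ge_zero)
  have M_ge: "M \<ge> \<omega> - real n * pi"
  proof -
    have "g 1 - g (-1) \<le> 2 * (real (size P) * pi)"
      unfolding g_def using sum_arctan_diff_le[of 1 P "-1"] by simp
    also have "\<dots> \<le> 2 * (real n * pi)"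
      using size by simp
    finally have "g 1 - g (-1) \<le> 2 * (real n * pi)" .
    moreover have "g 1 - \<omega> = - M" using e_even[of n] ends by (simp add: e_def)
    moreover have "g (-1) + \<omega> = M" by (simp add: M_def e_def)
    ultimately show ?thesis by simp
  qed
  have c_le: "\<omega> * c \<le> M" "c > 0"
    using M_ge \<omega>_gt \<omega>_pos by (simp_all add: c_def)
  \<comment> \<open>Otherwise at most \<open>n - 1\<close> arctangents increase; their sum \<open>h\<close> would have to supply the
    increase of \<open>g\<close> on all \<open>n\<close> rising intervals of \<open>e\<close>.\<close>
  have pos: "Re s > 0" if s: "s \<in># P" for s
  proof (rule ccontr)
    assume "\<not> Re s > 0"
    define Q where "Q = filter_mset (\<lambda>s. Re s > 0) P"
    define h where "h = (\<lambda>t. \<Sum>s\<in>#Q. arctan ((t - Im s) / Re s))"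
    define N where "N = filter_mset (\<lambda>s. \<not> Re s > 0) P"
    have PQN: "P = Q + N" by (simp add: Q_def N_def)
    have "s \<in># N" using s \<open>\<not> Re s > 0\<close> by (simp add: N_def)
    then have "size N \<ge> 1" by (cases N) auto
    then have "size Q \<le> n - 1" using size PQN by simp
    then have size_Q: "real (size Q) \<le> real n - 1" using \<open>n \<ge> 1\<close> by linarith
    have h_mono: "mono h"
      unfolding h_def by (rule mono_sum_arctan) (simp add: Q_def)
    have g_le_h: "g b - g a \<le> 2 * (h b - h a)" if "a \<le> b" for a b
    proof -
      have "(\<Sum>s\<in>#N. arctan ((b - Im s) / Re s)) \<le> (\<Sum>s\<in>#N. arctan ((a - Im s) / Re s))"
        using that by (intro sum_mset_mono arctan_monotone' divide_right_mono_neg)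
          (auto simp: N_def)
      then show ?thesis by (simp add: g_def h_def PQN)
    qed
    have rise: "real i * M \<le> h (\<eta> (2 * i + 1)) - h (-1)" if "i \<le> n" for i
      using that
    proof (induction i)
      case 0
      then show ?case by (simp add: ends flip: One_nat_def)
    next
      case (Suc i)
      have less: "\<eta> (2 * i + 1) < \<eta> (2 * i + 2)" "\<eta> (2 * i + 2) < \<eta> (2 * i + 3)"
        using \<eta>_less[of "2 * i + 1"] \<eta>_less[of "2 * i + 2"] Suc.prems by (simp_all add: numeral_3_eq_3)
      have "2 * M + \<omega> * (\<eta> (2 * i + 3) - \<eta> (2 * i + 2)) = g (\<eta> (2 * i + 3)) - g (\<eta> (2 * i + 2))"
        using e_odd[of "Suc i"] e_even[of i] Suc.prems
        by (simp add: e_def algebra_simps numeral_3_eq_3)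
      also have "\<dots> \<le> 2 * (h (\<eta> (2 * i + 3)) - h (\<eta> (2 * i + 2)))"
        using less by (intro g_le_h) simp
      finally have "M \<le> h (\<eta> (2 * i + 3)) - h (\<eta> (2 * i + 2))"
        using less mult_pos_pos[OF \<omega>_pos, of "\<eta> (2 * i + 3) - \<eta> (2 * i + 2)"] by simp
      moreover have "h (\<eta> (2 * i + 1)) \<le> h (\<eta> (2 * i + 2))"
        using less by (intro monoD[OF h_mono]) simp
      ultimately show ?case using Suc by (simp add: algebra_simps numeral_3_eq_3)
    qed
    have "real n * (\<omega> - real n * pi) \<le> real n * M"
      using M_ge by (intro mult_left_mono) auto
    also have "\<dots> \<le> h (\<eta> (2 * n + 1)) - h (-1)" by (rule rise) simp
    also have "\<dots> \<le> real (size Q) * pi"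
      unfolding h_def by (rule sum_arctan_diff_le)
    also have "\<dots> \<le> (real n - 1) * pi"
      using size_Q by (intro mult_right_mono) auto
    finally show False using \<omega> by simp
  qed
  have g_mono: "g a \<le> g b" if "a \<le> b" for a b
  proof -
    have "Re s \<ge> 0" if "s \<in># P" for s
      using pos[OF that] by simp
    then show ?thesis
      using monoD[OF mono_sum_arctan[of P] that] by (simp add: g_def)
  qed
  have gap: "\<eta> (2 * i + 1) + c \<le> x (2 * i + 1)" "x (2 * i + 1) + c \<le> \<eta> (2 * i + 2)" if "i \<le> n" for i
  proof -
    have "\<omega> * c \<le> \<omega> * (x (2 * i + 1) - \<eta> (2 * i + 1))"
      using g_mono[of "\<eta> (2 * i + 1)" "x (2 * i + 1)"] alternate[of "2 * i + 1"]
        zeros[of "2 * i + 1"] e_odd[OF that] c_le that by (simp add: e_def algebra_simps)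
    then show "\<eta> (2 * i + 1) + c \<le> x (2 * i + 1)" using \<omega>_pos by simp
    have "\<omega> * c \<le> \<omega> * (\<eta> (2 * i + 2) - x (2 * i + 1))"
      using g_mono[of "x (2 * i + 1)" "\<eta> (2 * i + 2)"] alternate[of "2 * i + 1"]
        zeros[of "2 * i + 1"] e_even[OF that] c_le that by (simp add: e_def algebra_simps)
    then show "x (2 * i + 1) + c \<le> \<eta> (2 * i + 2)" using \<omega>_pos by simp
  qed
  have spread: "\<eta> (2 * a + 1) + 2 * real i * c \<le> \<eta> (2 * (a + i) + 1)" if "a + i \<le> n" for a i
    using that
  proof (induction i)
    case (Suc i)
    have "\<eta> (2 * (a + i) + 2) < \<eta> (2 * (a + i) + 3)"
      using \<eta>_less[of "2 * (a + i) + 2"] Suc.prems by (simp add: numeral_3_eq_3)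
    then show ?case
      using gap[of "a + i"] Suc by (simp add: algebra_simps numeral_3_eq_3)
  qed simp
  have lower: "-1 + 2 * real i * c \<le> \<eta> (2 * i + 1)" if "i \<le> n" for i
    using spread[of 0 i] that ends by simp
  have upper: "\<eta> (2 * i + 1) \<le> 1 - 2 * (real n - real i) * c - 2 * c" if "i \<le> n" for i
    using spread[of i "n - i"] gap[of n] that ends by (simp add: of_nat_diff)
  have \<eta>_bounds: "-1 + real (2 * j) * c \<le> \<eta> (2 * j) \<and> \<eta> (2 * j) \<le> \<eta> (2 * j + 1) \<and>
      \<eta> (2 * j + 1) \<le> 1 - (real (2 * n + 2) - real (2 * j)) * c" if j: "j \<in> {1..n}" for j
  proof -
    obtain i where i: "j = Suc i" "i \<le> n" using j by (cases j) auto
    have "-1 + real (2 * j) * c \<le> \<eta> (2 * j)"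
      using lower[OF i(2)] gap[OF i(2)] by (simp add: i(1) algebra_simps)
    then show ?thesis
      using j upper[of j] \<eta>_less[of "2 * j"] by (simp add: of_nat_diff algebra_simps)
  qed
  show "-1 + real (2 * j) * c \<le> \<eta> (2 * j) \<and> \<eta> (2 * j) \<le> \<eta> (2 * j + 1) \<and>
      \<eta> (2 * j + 1) \<le> 1 - (real (2 * n + 2) - real (2 * j)) * c" if "j \<in> {1..n}"
    using \<eta>_bounds[OF that] .
  show "-1 + real k * c \<le> x k \<and> x k \<le> 1 - (real (2 * n + 2) - real k) * c"
    if k: "k \<in> {1..2 * n + 1}"
  proof (cases "even k")
    case True
    then obtain j where "k = 2 * j" by blast
    then show ?thesis using \<eta>_bounds[of j] alternate[of k] k by simp
  next
    case False
    then obtain i where i: "k = 2 * i + 1" by (rule oddE)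
    then have "i \<le> n" using k by simp
    from lower[OF this] have 1: "-1 + real k * c \<le> x k"
      using gap(1)[OF \<open>i \<le> n\<close>] by (simp add: i algebra_simps)
    have "\<eta> (2 * i + 2) \<le> 1 - 2 * (real n - real i) * c"
    proof (cases "i = n")
      case False
      then show ?thesis
        using upper[of "Suc i"] \<eta>_less[of "2 * i + 2"] \<open>i \<le> n\<close> by (simp add: algebra_simps)
    qed (use ends in simp)
    then show ?thesis using 1 gap(2)[OF \<open>i \<le> n\<close>] by (simp add: i algebra_simps)
  qed
qed

theorem proposition9p5:
  fixes n :: nat
    and r :: "real \<Rightarrow> complex poly fract"
    and g :: "real \<Rightarrow> real \<Rightarrow> real"
    and x \<eta> :: "real \<Rightarrow> nat \<Rightarrow> real"
  assumes "n \<ge> 1"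
    and "\<And>\<omega>. \<omega> \<in> {0<..<(real n + 1) * pi} \<Longrightarrow> is_best_approximation n \<omega> (r \<omega>)"
    and "\<And>\<omega>. \<omega> \<in> {0<..<(real n + 1) * pi} \<Longrightarrow> is_phase_function \<omega> (r \<omega>) (g \<omega>)"
    and "\<And>\<omega>. \<omega> \<in> {0<..<(real n + 1) * pi} \<Longrightarrow>
           ascending_enumeration (2 * n + 1) (node_positions \<omega> (g \<omega>)) (x \<omega>)"
    and "\<And>\<omega>. \<omega> \<in> {0<..<(real n + 1) * pi} \<Longrightarrow>
           ascending_enumeration (2 * n + 2) (equioscillation_points \<omega> (g \<omega>)) (\<eta> \<omega>)"
  shows "(\<forall>k\<in>{1..2 * n + 1}.
            ((\<lambda>\<omega>. x \<omega> k) \<longlongrightarrow> -1 + real k / (real n + 1)) (at_left ((real n + 1) * pi)))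
       \<and> (\<forall>\<omega>\<in>{0<..<(real n + 1) * pi}. \<eta> \<omega> 1 = -1 \<and> \<eta> \<omega> (2 * n + 2) = 1)
       \<and> (\<forall>j\<in>{1..n}.
            ((\<lambda>\<omega>. \<eta> \<omega> (2 * j)) \<longlongrightarrow> -1 + 2 * real j / (real n + 1)) (at_left ((real n + 1) * pi))
          \<and> ((\<lambda>\<omega>. \<eta> \<omega> (2 * j + 1)) \<longlongrightarrow> -1 + 2 * real j / (real n + 1)) (at_left ((real n + 1) * pi)))
       \<and> (\<forall>\<omega>\<in>{0<..<(real n + 1) * pi}. \<forall>j\<in>{1..n}.
            \<eta> \<omega> (2 * j) < x \<omega> (2 * j) \<and> x \<omega> (2 * j) < \<eta> \<omega> (2 * j + 1))"
proof -
  define \<Omega> where "\<Omega> = (real n + 1) * pi"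
  define c where "c \<omega> = (\<omega> - real n * pi) / \<omega>" for \<omega>
  define \<theta> where "\<theta> \<omega> = (SOME \<theta>. \<forall>t. g \<omega> t = \<theta> + 2 * (\<Sum>s\<in>#rat_poles (r \<omega>). arctan ((t - Im s) / Re s)))" for \<omega>
  have g_eq: "g \<omega> = (\<lambda>t. \<theta> \<omega> + 2 * (\<Sum>s\<in>#rat_poles (r \<omega>). arctan ((t - Im s) / Re s)))"
    if "\<omega> \<in> {0<..<\<Omega>}" for \<omega>
    using assms(3)[of \<omega>] that someI_ex[where P = "\<lambda>\<theta>. \<forall>t. g \<omega> t = \<theta> +
        2 * (\<Sum>s\<in>#rat_poles (r \<omega>). arctan ((t - Im s) / Re s))"]
    unfolding is_phase_function_def \<Omega>_def \<theta>_def by blast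
  have size: "size (rat_poles (r \<omega>)) \<le> n" if "\<omega> \<in> {0<..<\<Omega>}" for \<omega>
    using assms(2)[of \<omega>] that size_rat_poles_le by (simp add: is_best_approximation_def \<Omega>_def)
  have interlacing: "\<eta> \<omega> 1 = -1 \<and> \<eta> \<omega> (2 * n + 2) = 1 \<and> (\<forall>j\<in>{1..2 * n + 1}.
      \<eta> \<omega> j < x \<omega> j \<and> x \<omega> j < \<eta> \<omega> (Suc j) \<and>
      phase_error \<omega> (g \<omega>) (\<eta> \<omega> (Suc j)) = - phase_error \<omega> (g \<omega>) (\<eta> \<omega> j))"
    if \<omega>: "\<omega> \<in> {0<..<\<Omega>}" for \<omega>
  proof -
    define e' where "e' t = 2 * (\<Sum>s\<in>#rat_poles (r \<omega>). Re s / ((Re s)\<^sup>2 + (t - Im s)\<^sup>2)) - \<omega>" for t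
    have deriv: "(phase_error \<omega> (g \<omega>) has_real_derivative e' t) (at t)" for t
      unfolding phase_error_def[abs_def] g_eq[OF \<omega>] e'_def
      by (rule derivative_eq_intros sum_arctan_has_real_derivative refl | simp)+
    have crit: "{t. e' t = 0} = UNIV \<or> finite {t. e' t = 0} \<and> card {t. e' t = 0} \<le> 2 * n"
      using card_critical_points_sum_arctan_le[of "rat_poles (r \<omega>)" \<omega>] size[OF \<omega>]
      unfolding e'_def by linarith
    have nodes: "ascending_enumeration (2 * n + 1) {t \<in> {-1..1}. phase_error \<omega> (g \<omega>) t = 0} (x \<omega>)"
      using assms(4)[of \<omega>] \<omega> by (simp add: node_positions_def \<Omega>_def)
    have extrema: "ascending_enumeration (2 * n + 2) {t \<in> {-1..1}. \<forall>y\<in>{-1..1}.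
        \<bar>phase_error \<omega> (g \<omega>) y\<bar> \<le> \<bar>phase_error \<omega> (g \<omega>) t\<bar>} (\<eta> \<omega>)"
      using assms(5)[of \<omega>] \<omega> by (simp add: equioscillation_points_def \<Omega>_def)
    show ?thesis
      using nodes_separate_extrema[OF deriv crit nodes extrema] by blast
  qed
  have bounds: "(\<forall>k\<in>{1..2 * n + 1}. -1 + real k * c \<omega> \<le> x \<omega> k \<and>
        x \<omega> k \<le> 1 - (real (2 * n + 2) - real k) * c \<omega>) \<and>
      (\<forall>j\<in>{1..n}. -1 + real (2 * j) * c \<omega> \<le> \<eta> \<omega> (2 * j) \<and> \<eta> \<omega> (2 * j) \<le> \<eta> \<omega> (2 * j + 1) \<and>
        \<eta> \<omega> (2 * j + 1) \<le> 1 - (real (2 * n + 2) - real (2 * j)) * c \<omega>)"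
    if \<omega>: "\<omega> \<in> {\<Omega> - pi / real n<..<\<Omega>}" for \<omega>
  proof -
    \<comment> \<open>The left end of this range of \<open>\<omega>\<close> is where \<open>\<omega> - n \<pi>\<close> equals \<open>(n - 1) \<pi> / n\<close>.\<close>
    have n_pos: "real n > 0" using \<open>n \<ge> 1\<close> by simp
    have "real n * (\<omega> - real n * pi) > real n * (\<Omega> - pi / real n - real n * pi)"
      using \<omega> n_pos by (intro mult_strict_left_mono) auto
    also have "real n * (\<Omega> - pi / real n - real n * pi) = (real n - 1) * pi"
      using n_pos by (simp add: \<Omega>_def field_simps)
    finally have large: "real n * (\<omega> - real n * pi) > (real n - 1) * pi" .
    have "(real n - 1) * pi \<ge> 0" using \<open>n \<ge> 1\<close> by simp
    then have "\<omega> - real n * pi > 0" 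
      using large n_pos by (smt (verit) zero_less_mult_pos)
    then have \<omega>': "\<omega> \<in> {0<..<\<Omega>}" 
      using \<omega> n_pos pi_gt_zero by (smt (verit) greaterThanLessThan_iff mult_pos_pos)
    note str = interlacing[OF \<omega>']
    have zeros: "phase_error \<omega> (g \<omega>) (x \<omega> j) = 0" if "j \<in> {1..2 * n + 1}" for j
      using assms(4)[of \<omega>] \<omega>' that by (auto simp: ascending_enumeration_def node_positions_def \<Omega>_def)
    note gaps = equioscillation_gap_bounds[OF \<open>n \<ge> 1\<close> size[OF \<omega>'] large,
        of "\<eta> \<omega>" "\<theta> \<omega>" "x \<omega>", folded g_eq[OF \<omega>']]
    show ?thesis
      using gaps str zeros unfolding c_def phase_error_def g_eq[OF \<omega>'] by blast
  qed
  have near: "eventually (\<lambda>\<omega>. \<omega> \<in> {\<Omega> - pi / real n<..<\<Omega>}) (at_left \<Omega>)"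
    using \<open>n \<ge> 1\<close> by (intro eventually_at_leftI) auto
  have "real n + 1 \<noteq> 0" by linarith
  then have "\<Omega> \<noteq> 0" unfolding \<Omega>_def mult_eq_0_iff using pi_neq_zero by blast
  then have "(c \<longlongrightarrow> (\<Omega> - real n * pi) / \<Omega>) (at_left \<Omega>)"
    unfolding c_def by (intro tendsto_intros)
  also have "(\<Omega> - real n * pi) / \<Omega> = 1 / (real n + 1)"
    using \<open>\<Omega> \<noteq> 0\<close> by (simp add: \<Omega>_def divide_simps algebra_simps)
  finally have c_lim: "(c \<longlongrightarrow> 1 / (real n + 1)) (at_left \<Omega>)" .
  have lower_lim: "((\<lambda>\<omega>. -1 + real k * c \<omega>) \<longlongrightarrow> -1 + real k / (real n + 1)) (at_left \<Omega>)" for k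
    using tendsto_add[OF tendsto_const tendsto_mult[OF tendsto_const c_lim], of "-1" "real k"] by simp
  have upper_lim: "((\<lambda>\<omega>. 1 - (real (2 * n + 2) - real k) * c \<omega>) \<longlongrightarrow> -1 + real k / (real n + 1))
      (at_left \<Omega>)" for k
  proof -
    have "1 - (real (2 * n + 2) - real k) * (1 / (real n + 1)) = -1 + real k / (real n + 1)"
      by (simp add: field_simps)
    then show ?thesis
      using tendsto_diff[OF tendsto_const tendsto_mult[OF tendsto_const c_lim],
          of 1 "real (2 * n + 2) - real k"] by (simp only:)
  qed
  have squeeze: "((\<lambda>\<omega>. f \<omega>) \<longlongrightarrow> -1 + real k / (real n + 1)) (at_left \<Omega>)"
    if "\<And>\<omega>. \<omega> \<in> {\<Omega> - pi / real n<..<\<Omega>} \<Longrightarrow>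
          -1 + real k * c \<omega> \<le> f \<omega> \<and> f \<omega> \<le> 1 - (real (2 * n + 2) - real k) * c \<omega>" for f k
    using that
    by (intro tendsto_sandwich[OF _ _ lower_lim upper_lim] eventually_mono[OF near]) auto
  have "((\<lambda>\<omega>. x \<omega> k) \<longlongrightarrow> -1 + real k / (real n + 1)) (at_left \<Omega>)" if "k \<in> {1..2 * n + 1}" for k
    using that bounds by (intro squeeze) blast
  moreover have "((\<lambda>\<omega>. \<eta> \<omega> (2 * j)) \<longlongrightarrow> -1 + 2 * real j / (real n + 1)) (at_left \<Omega>)
      \<and> ((\<lambda>\<omega>. \<eta> \<omega> (2 * j + 1)) \<longlongrightarrow> -1 + 2 * real j / (real n + 1)) (at_left \<Omega>)"
    if j: "j \<in> {1..n}" for j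
  proof -
    have pair: "-1 + real (2 * j) * c \<omega> \<le> \<eta> \<omega> (2 * j)" "\<eta> \<omega> (2 * j) \<le> \<eta> \<omega> (2 * j + 1)"
      "\<eta> \<omega> (2 * j + 1) \<le> 1 - (real (2 * n + 2) - real (2 * j)) * c \<omega>"
      if "\<omega> \<in> {\<Omega> - pi / real n<..<\<Omega>}" for \<omega>
      using bounds[OF that] j by blast+
    have "((\<lambda>\<omega>. \<eta> \<omega> (2 * j)) \<longlongrightarrow> -1 + real (2 * j) / (real n + 1)) (at_left \<Omega>)"
      by (rule squeeze) (use pair in \<open>blast intro: order_trans\<close>)
    moreover have "((\<lambda>\<omega>. \<eta> \<omega> (2 * j + 1)) \<longlongrightarrow> -1 + real (2 * j) / (real n + 1)) (at_left \<Omega>)"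
      by (rule squeeze) (use pair in \<open>blast intro: order_trans\<close>)
    ultimately show ?thesis by simp
  qed
  moreover have "\<eta> \<omega> (2 * j) < x \<omega> (2 * j) \<and> x \<omega> (2 * j) < \<eta> \<omega> (2 * j + 1)"
    if "\<omega> \<in> {0<..<\<Omega>}" "j \<in> {1..n}" for \<omega> j
    using interlacing[OF that(1)] that(2) by simp
  ultimately show ?thesis
    using interlacing unfolding \<Omega>_def by blast
qed

end
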